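(* Let $r\ge1$ be an integer, $k_1,\dots,k_r$ integers, $a$ a complex number that is not an integer $\le r-1$, and $x$ a variable. Then for every integer $n\ge0$, $$B^{(k_1,\dots,k_r)}_{n,a}(x)=\sum_{0\le m_1\le m_2\le\dots\le m_r\le n}\frac{m_r!\,\left\{ n \atop m_r\right\}_{-1,\,xr}}{(m_1+a-r+1)^{k_1}(m_2+a-r+2)^{k_2}\cdots(m_r+a)^{k_r}}.$$
   Context: The generalized Hurwitz–Lerch multiple zeta function is the formal power series in $z$ $$\Phi_{(k_1,\dots,k_r)}(z,a)=\sum_{0\le m_1\le m_2\le\dots\le m_r}\frac{z^{m_r}}{(m_1+a-r+1)^{k_1}(m_2+a-r+2)^{k_2}\cdots(m_r+a)^{k_r}}$$ (the condition on $a$ ensures no denominator vanishes). The Hurwitz–Lerch type multi poly-Bernoulli polynomials are defined by $$\Phi_{(k_1,\dots,k_r)}(1-e^{-t},a)\,e^{rxt}=\sum_{n=0}^\infty B^{(k_1,\dots,k_r)}_{n,a}(x)\frac{t^n}{n!}.$$ For a number $\beta\ne0$ and a parameter $\rho$, the $(\rho,\beta)$-Stirling numbers $\left\{ n \atop m\right\}_{\beta,\rho}$ are defined by $\frac{1}{\beta^m m!}e^{\rho t}(e^{\beta t}-1)^m=\sum_{n=0}^\infty\left\{ n \atop m\right\}_{\beta,\rho}\frac{t^n}{n!}$; in the claim $\beta=-1$ and $\rho=xr$. *)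

theory Defs
  imports "HOL-Computational_Algebra.Computational_Algebra" Complex_Main
begin

text \<open>
  The variable \<open>x\<close> is the indeterminate of \<open>complex poly\<close>, and generating functions in \<open>t\<close>
  that involve it live in \<open>complex poly fps\<close>. Series without \<open>x\<close> are built in \<open>complex fps\<close>
  and embedded coefficientwise.
\<close>

definition fps_lift :: "complex fps \<Rightarrow> complex poly fps" where
  "fps_lift F = Abs_fps (\<lambda>n. [:fps_nth F n:])"

text \<open>
  The series \<open>exp (p t)\<close> for a polynomial \<open>p\<close>; \<^const>\<open>fps_exp\<close> requires a coefficient field.
\<close>

definition fps_exp_poly :: "complex poly \<Rightarrow> complex poly fps" where
  "fps_exp_poly p = Abs_fps (\<lambda>n. smult (1 / fact n) (p ^ n))"

text \<open>
  The denominator, with \<open>r = length ks\<close>. Lists are indexed from 0, so the factor number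
  \<open>i + 1\<close> has base \<open>m + a - r + (i + 1)\<close> with \<open>m = ms ! i\<close>.
\<close>

definition hl_denom :: "int list \<Rightarrow> complex \<Rightarrow> nat list \<Rightarrow> complex" where
  "hl_denom ks a ms =
     (\<Prod>i<length ks. (of_nat (ms ! i) + a - of_nat (length ks) + of_nat (i + 1)) powi (ks ! i))"

text \<open>
  The coefficient of \<open>z ^ N\<close> collects the finitely many tuples \<open>m\<^sub>1 \<le> \<dots> \<le> m\<^sub>r\<close> with \<open>m\<^sub>r = N\<close>.
\<close>

definition hurwitz_lerch :: "int list \<Rightarrow> complex \<Rightarrow> complex fps" where
  "hurwitz_lerch ks a = Abs_fps (\<lambda>N.
     \<Sum>ms | length ms = length ks \<and> sorted ms \<and> last ms = N. 1 / hl_denom ks a ms)"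

definition multi_poly_bernoulli :: "int list \<Rightarrow> nat \<Rightarrow> complex \<Rightarrow> complex poly" where
  "multi_poly_bernoulli ks n a = smult (fact n)
     (fps_nth (fps_lift (hurwitz_lerch ks a oo (1 - fps_exp (- 1)))
               * fps_exp_poly (of_nat (length ks) * [:0, 1:])) n)"

definition rb_stirling :: "complex poly \<Rightarrow> complex \<Rightarrow> nat \<Rightarrow> nat \<Rightarrow> complex poly" where
  "rb_stirling \<rho> \<beta> n m = smult (fact n)
     (fps_nth (fps_exp_poly \<rho>
               * fps_lift (fps_const (1 / (\<beta> ^ m * fact m)) * (fps_exp \<beta> - 1) ^ m)) n)"

text \<open>Evaluating at a number recovers the generating functions with a numerical \<open>x\<close> or \<open>\<rho>\<close>.\<close>

lemma poly_fps_nth_lift_mult_exp: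
  "poly (fps_nth (fps_lift F * fps_exp_poly p) n) x = fps_nth (F * fps_exp (poly p x)) n"
  by (simp add: fps_mult_nth fps_lift_def fps_exp_poly_def poly_sum)

lemma poly_multi_poly_bernoulli:
  "poly (multi_poly_bernoulli ks n a) x = fact n *
     fps_nth ((hurwitz_lerch ks a oo (1 - fps_exp (- 1))) * fps_exp (of_nat (length ks) * x)) n"
proof -
  have "poly (of_nat (length ks) * [:0, 1:]) x = of_nat (length ks) * x"
    by (simp only: poly_mult of_nat_poly) simp
  then show ?thesis
    by (simp only: multi_poly_bernoulli_def poly_smult poly_fps_nth_lift_mult_exp)
qed

lemma poly_rb_stirling:
  "poly (rb_stirling \<rho> \<beta> n m) x = fact n *
     fps_nth (fps_const (1 / (\<beta> ^ m * fact m)) * fps_exp (poly \<rho> x) * (fps_exp \<beta> - 1) ^ m) n"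
  unfolding rb_stirling_def poly_smult mult.commute[of "fps_exp_poly \<rho>"]
    poly_fps_nth_lift_mult_exp by (simp only: mult_ac)

end

theory Submission
  imports Defs
begin

text \<open>
  Since \<open>1 - e\<^bsup>-t\<^esup>\<close> has no constant term, only the powers \<open>m \<le> n\<close> contribute to the
  coefficient of \<open>t ^ n\<close> of the composition, and
  \<open>(1 - e\<^bsup>-t\<^esup>) ^ m = m! \<sqdot> (e\<^bsup>-t\<^esup> - 1) ^ m / ((-1) ^ m m!)\<close> turns each of them into a
  Stirling number.
\<close>

lemma fps_compose_mult_nth:
  fixes F G E :: "'a :: comm_ring_1 fps"
  assumes "fps_nth G 0 = 0"
  shows "fps_nth ((F oo G) * E) n = (\<Sum>m\<le>n. fps_nth F m * fps_nth (G ^ m * E) n)"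
proof -
  \<comment> \<open>Cutting off at \<open>n\<close> instead of \<open>i\<close> gives every
    coefficient up to \<open>n\<close> the same range of \<open>m\<close>, so the two sums below can
    be swapped. The extra terms vanish because \<open>G ^ m\<close> has no terms of degree below
    \<open>m\<close>.\<close>
  have compose: "fps_nth (F oo G) i = (\<Sum>m\<le>n. fps_nth F m * fps_nth (G ^ m) i)" if "i \<le> n" for i
    unfolding fps_compose_nth
    using that startsby_zero_power_prefix[OF assms]
    by (intro sum.mono_neutral_left) auto
  have "fps_nth ((F oo G) * E) n =
      (\<Sum>i=0..n. \<Sum>m\<le>n. fps_nth F m * (fps_nth (G ^ m) i * fps_nth E (n - i)))"
    by (simp add: fps_mult_nth compose sum_distrib_right mult.assoc)
  also have "\<dots> = (\<Sum>m\<le>n. fps_nth F m * fps_nth (G ^ m * E) n)"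
    by (subst sum.swap) (simp add: fps_mult_nth sum_distrib_left)
  finally show ?thesis .
qed

text \<open>The last entry of a sorted list bounds all others, so the entries come from
  \<open>{..n}\<close>. This permits regrouping the final sum by last entry.\<close>

lemma finite_sorted_lists_last_le:
  "finite {ms :: nat list. length ms = r \<and> sorted ms \<and> last ms \<le> n}"
proof (rule finite_subset)
  show "{ms. length ms = r \<and> sorted ms \<and> last ms \<le> n} \<subseteq> {ms. set ms \<subseteq> {..n} \<and> length ms = r}"
  proof clarsimp
    fix ms :: "nat list" and m
    assume "sorted ms" "last ms \<le> n" "m \<in> set ms"
    moreover have "m \<le> last ms"
      using \<open>sorted ms\<close> \<open>m \<in> set ms\<close> by (induction ms) auto
    ultimately show "m \<le> n" by simp
  qed
qed (rule finite_lists_length_eq, simp)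

lemma poly_fact_smult_rb_stirling_neg_one:
  "poly (smult (fact m) (rb_stirling \<rho> (- 1) n m)) x =
     fact n * fps_nth ((1 - fps_exp (- 1)) ^ m * fps_exp (poly \<rho> x)) n"
proof -
  have minus_power: "(1 - fps_exp (- 1) :: complex fps) ^ m = (- 1) ^ m * (fps_exp (- 1) - 1) ^ m"
    by (simp flip: power_mult_distrib)
  \<comment> \<open>The sign is its own inverse. Writing it this way supplies both the outer factor
    \<open>fact m\<close> and the normalizing constant inside \<open>rb_stirling\<close>.\<close>
  have const: "((- 1) ^ m :: complex fps) = fps_const (fact m) * fps_const (1 / ((- 1) ^ m * fact m))"
    by (cases "even m") simp_all
  show ?thesis
    unfolding poly_smult poly_rb_stirling minus_power const
    by (simp only: mult.assoc fps_mult_left_const_nth) (simp only: mult_ac)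
qed

theorem theorem5p1:
  fixes r n :: nat and ks :: "int list" and a :: complex
  assumes "r \<ge> 1"
    and "length ks = r"
    and "\<And>j :: int. j \<le> int r - 1 \<Longrightarrow> a \<noteq> of_int j"
  shows "multi_poly_bernoulli ks n a =
    (\<Sum>ms | length ms = r \<and> sorted ms \<and> last ms \<le> n.
       smult (fact (last ms) / hl_denom ks a ms)
         (rb_stirling ([:0, 1:] * of_nat r) (- 1) n (last ms)))"
proof -
  let ?S = "{ms. length ms = r \<and> sorted ms \<and> last ms \<le> n}"
  let ?T = "\<lambda>m. {ms \<in> ?S. last ms = m}"
  let ?c = "\<lambda>m. \<Sum>ms\<in>?T m. 1 / hl_denom ks a ms"
  let ?q = "\<lambda>m. smult (fact m) (rb_stirling ([:0, 1:] * of_nat r) (- 1) n m)"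
  have coeff: "fps_nth (hurwitz_lerch ks a) m = ?c m" if "m \<le> n" for m
    unfolding hurwitz_lerch_def fps_nth_Abs_fps
    using that assms(2) by (intro sum.cong) auto
  have "multi_poly_bernoulli ks n a = (\<Sum>m\<le>n. smult (?c m) (?q m))"
  \<comment> \<open>Over the infinite field of complex numbers a polynomial is determined by its
    values; evaluating at \<open>x\<close> moves the computation to
    \<open>complex fps\<close>.\<close>
  proof (rule poly_eq_poly_eq_iff[THEN iffD1], rule ext)
    fix x :: complex
    have x: "poly ([:0, 1:] * of_nat r) x = of_nat (length ks) * x"
      using assms(2) by (simp only: poly_mult of_nat_poly) (simp add: mult.commute)
    have "poly (multi_poly_bernoulli ks n a) x =
        (\<Sum>m\<le>n. ?c m * (fact n *
          fps_nth ((1 - fps_exp (- 1)) ^ m * fps_exp (of_nat (length ks) * x)) n))"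
      unfolding poly_multi_poly_bernoulli
      by (subst fps_compose_mult_nth)
        (simp_all add: coeff sum_distrib_left mult.left_commute del: mem_Collect_eq)
    also have "\<dots> = poly (\<Sum>m\<le>n. smult (?c m) (?q m)) x"
      by (simp only: poly_sum poly_smult[of "?c _"] poly_fact_smult_rb_stirling_neg_one x)
    finally show "poly (multi_poly_bernoulli ks n a) x = poly (\<Sum>m\<le>n. smult (?c m) (?q m)) x" .
  qed
  \<comment> \<open>On the fibre \<open>?T m\<close> the index \<open>m\<close> is
    \<open>last ms\<close>, so the summand no longer depends on \<open>m\<close> and the fibres can
    be merged into \<open>?S\<close>.\<close>
  also have "\<dots> = (\<Sum>m\<le>n. \<Sum>ms\<in>?T m. smult (1 / hl_denom ks a ms) (?q (last ms)))"
    unfolding smult_sum by (intro sum.cong refl) auto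
  also have "\<dots> = (\<Sum>ms\<in>?S. smult (1 / hl_denom ks a ms) (?q (last ms)))"
    using finite_sorted_lists_last_le by (intro sum.group) auto
  finally show ?thesis by simp
qed

end
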